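(* Let $\alpha\in(0,1)$, let $\Delta_2=[a_1,b_1]\times[a_2,b_2]\subset\mathbb{R}^2$, and for $i=1,2$ let $P_{t_i}=\langle a_i,t_i,b_i,p_i,q_i\rangle$ be a parameter set with $p_i,q_i\in\mathbb{R}$. Let $k_\alpha$ be a difference kernel, i.e. $k_\alpha(t_i,\tau)=k_\alpha(t_i-\tau)$, such that $k_\alpha\in L_1([0,b_i-a_i])$ for $i=1,2$. If $f,g,\eta_1,\eta_2\in C(\Delta_2)$, then, writing $\mathbf{t}=(t_1,t_2)$, $$\int_{a_1}^{b_1}\int_{a_2}^{b_2}\left[g(\mathbf{t})\left(K_{P_{t_1}}^{\alpha}\eta_1\right)(\mathbf{t})+f(\mathbf{t})\left(K_{P_{t_2}}^{\alpha}\eta_2\right)(\mathbf{t})\right]dt_2\,dt_1=\int_{a_1}^{b_1}\int_{a_2}^{b_2}\left[\eta_1(\mathbf{t})\left(K_{P_{t_1}^*}^{\alpha}g\right)(\mathbf{t})+\eta_2(\mathbf{t})\left(K_{P_{t_2}^*}^{\alpha}f\right)(\mathbf{t})\right]dt_2\,dt_1,$$ where $P_{t_i}^*=\langle a_i,t_i,b_i,q_i,p_i\rangle$ is the dual of $P_{t_i}$, $i=1,2$.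
   Context: All functions are real-valued and $a_i<b_i$ for $i=1,2$. A kernel $k_\alpha(t,\tau)$ is a real function which may depend on the parameter $\alpha$; it is a difference kernel if $k_\alpha(t,\tau)=k_\alpha(t-\tau)$ for a function $k_\alpha$ of one variable (only evaluated at nonnegative arguments below). Generalized partial fractional integrals: for a parameter set $P_{t_i}=\langle a_i,t_i,b_i,p_i,q_i\rangle$ and $h$ continuous on $\Delta_2=[a_1,b_1]\times[a_2,b_2]$, $$\left(K_{P_{t_1}}^{\alpha}h\right)(t_1,t_2):=p_1\int_{a_1}^{t_1}k_\alpha(t_1-\tau)h(\tau,t_2)\,d\tau+q_1\int_{t_1}^{b_1}k_\alpha(\tau-t_1)h(\tau,t_2)\,d\tau,$$ $$\left(K_{P_{t_2}}^{\alpha}h\right)(t_1,t_2):=p_2\int_{a_2}^{t_2}k_\alpha(t_2-\tau)h(t_1,\tau)\,d\tau+q_2\int_{t_2}^{b_2}k_\alpha(\tau-t_2)h(t_1,\tau)\,d\tau.$$ The dual of $P_{t_i}=\langle a_i,t_i,b_i,p_i,q_i\rangle$ is $P_{t_i}^*=\langle a_i,t_i,b_i,q_i,p_i\rangle$; thus $K_{P_{t_i}^*}^{\alpha}$ is given by the same formula as $K_{P_{t_i}}^{\alpha}$ with $p_i$ and $q_i$ interchanged. *)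

theory Defs
  imports "HOL-Analysis.Analysis"
begin

text \<open>The parameter set \<open>\<langle>a, t, b, p, q\<rangle>\<close>. Its entry \<open>t\<close> is the variable at which the operator
  is evaluated, so it is not stored but appears as the argument of the operators below.\<close>

datatype param_set = Param (lower: real) (upper: real) (left_coeff: real) (right_coeff: real)

definition dual :: "param_set \<Rightarrow> param_set" where
  "dual P = Param (lower P) (upper P) (right_coeff P) (left_coeff P)"

text \<open>A difference kernel \<open>k\<^sub>\<alpha>(t, \<tau>) = k\<^sub>\<alpha>(t - \<tau>)\<close> is given by its function of one variable; the first
  argument of \<open>k\<close> is the parameter \<open>\<alpha>\<close>. All integrals are Lebesgue integrals.\<close>

definition K1 :: "(real \<Rightarrow> real \<Rightarrow> real) \<Rightarrow> param_set \<Rightarrow> real \<Rightarrow> (real \<times> real \<Rightarrow> real) \<Rightarrow> real \<times> real \<Rightarrow> real"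
where
  "K1 k P \<alpha> h = (\<lambda>(t1, t2).
     left_coeff P * (LINT \<tau>:{lower P..t1}|lebesgue. k \<alpha> (t1 - \<tau>) * h (\<tau>, t2)) +
     right_coeff P * (LINT \<tau>:{t1..upper P}|lebesgue. k \<alpha> (\<tau> - t1) * h (\<tau>, t2)))"

definition K2 :: "(real \<Rightarrow> real \<Rightarrow> real) \<Rightarrow> param_set \<Rightarrow> real \<Rightarrow> (real \<times> real \<Rightarrow> real) \<Rightarrow> real \<times> real \<Rightarrow> real"
where
  "K2 k P \<alpha> h = (\<lambda>(t1, t2).
     left_coeff P * (LINT \<tau>:{lower P..t2}|lebesgue. k \<alpha> (t2 - \<tau>) * h (t1, \<tau>)) +
     right_coeff P * (LINT \<tau>:{t2..upper P}|lebesgue. k \<alpha> (\<tau> - t2) * h (t1, \<tau>)))"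

end

theory Submission
  imports Defs
begin

text \<open>After replacing the kernel by a Borel representative \<open>\<kappa>\<close> that vanishes outside
  \<open>[0, b - a]\<close>, and the continuous functions by their extensions by zero, the operator with
  coefficients \<open>p, q\<close> becomes convolution with \<open>\<Phi> x = p * \<kappa> x + q * \<kappa> (- x)\<close>. Passing to the dual
  parameter set reflects \<open>\<Phi>\<close>, and the reflected convolution is the adjoint by Fubini's theorem.\<close>

section \<open>Null sets and Borel representatives\<close>

text \<open>No measurability of \<open>P\<close> is assumed, so the exceptional set is first covered
  by a Borel null set \<open>N\<close>; the affine change of variable is then applied to
  \<open>N\<close>.\<close>

lemma AE_lborel_real_affine:
  fixes P :: "real \<Rightarrow> bool"
  assumes "AE x in lborel. P x" and "c \<noteq> 0"
  shows "AE x in lborel. P (t + c * x)"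
proof -
  obtain N where N: "{x \<in> space lborel. \<not> P x} \<subseteq> N" "N \<in> null_sets lborel"
    using assms(1) unfolding eventually_ae_filter by auto
  then have [measurable]: "N \<in> sets borel" by auto
  have "AE x in lborel. x \<notin> N" using N by (simp add: AE_not_in)
  then have "AE x in lborel. t + c * x \<notin> N"
    by (intro AE_borel_affine[OF assms(2)]) auto
  then show ?thesis by eventually_elim (use N in auto)
qed

text \<open>Completeness of Lebesgue measure makes \<open>f\<close> measurable as soon as it agrees
  almost everywhere with the Borel function \<open>g\<close>. This moves integrals from
  \<open>lebesgue\<close> to \<open>lborel\<close>, where products and Fubini are applied.\<close>

lemma integral_lebesgue_cong_AE:
  fixes f g :: "real \<Rightarrow> real"
  assumes [measurable]: "g \<in> borel_measurable borel" and "AE x in lborel. f x = g x"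
  shows "integral\<^sup>L lebesgue f = integral\<^sup>L lborel g"
proof -
  have g: "g \<in> borel_measurable lebesgue"
    by (rule measurable_completion) simp
  have ae: "AE x in lebesgue. g x = f x"
    using AE_completion[OF assms(2)] by eventually_elim simp
  have "integral\<^sup>L lebesgue f = integral\<^sup>L lebesgue g"
    using ae by (intro integral_cong_AE borel_measurable_AE[OF g ae] g) auto
  also have "\<dots> = integral\<^sup>L lborel g"
    by (rule integral_completion) simp
  finally show ?thesis .
qed

lemma borel_representative:
  fixes k :: "real \<Rightarrow> real"
  assumes "set_integrable lebesgue {0..c} k"
  obtains \<kappa> where "integrable lborel \<kappa>"
    "AE x in lborel. x \<in> {0..c} \<longrightarrow> k x = \<kappa> x" "\<And>x. x \<notin> {0..c} \<Longrightarrow> \<kappa> x = 0"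
proof -
  have int: "integrable lebesgue (\<lambda>x. indicator {0..c} x * k x)"
    using assms by (simp add: set_integrable_def)
  obtain \<kappa>0 where [measurable]: "\<kappa>0 \<in> borel_measurable lborel"
    and ae: "AE x in lborel. indicator {0..c} x * k x = \<kappa>0 x"
    using completion_ex_borel_measurable_real[OF borel_measurable_integrable[OF int]] by blast
  \<comment> \<open>The indicator is inserted again because \<open>\<kappa>0\<close> is known to
    vanish outside the interval only almost everywhere, while the conclusion requires it at every
    point.\<close>
  define \<kappa> where "\<kappa> x = indicator {0..c} x * \<kappa>0 x" for x
  have [measurable]: "\<kappa> \<in> borel_measurable borel" unfolding \<kappa>_def by measurable
  have ae': "AE x in lborel. indicator {0..c} x * k x = \<kappa> x"
    using ae
  proof eventually_elim
    case (elim x)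
    then show ?case by (cases "x \<in> {0..c}") (auto simp: \<kappa>_def)
  qed
  have "integrable lebesgue \<kappa>"
    using int
  proof (rule integrable_cong_AE_imp)
    show "\<kappa> \<in> borel_measurable lebesgue" by (rule measurable_completion) simp
    show "AE x in lebesgue. indicator {0..c} x * k x = \<kappa> x"
      using AE_completion[OF ae'] by simp
  qed
  then have "integrable lborel \<kappa>" by (subst (asm) integrable_completion) auto
  moreover have "AE x in lborel. x \<in> {0..c} \<longrightarrow> k x = \<kappa> x"
    using ae' by eventually_elim (auto split: split_indicator_asm)
  ultimately show ?thesis using that by (simp add: \<kappa>_def)
qed

section \<open>Convolution on the line and its adjoint\<close>

lemma integrable_reflect_translate:
  fixes \<Phi> :: "real \<Rightarrow> real"
  assumes "integrable lborel \<Phi>"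
  shows "integrable lborel (\<lambda>\<tau>. \<Phi> (t - \<tau>))" "integrable lborel (\<lambda>\<tau>. \<Phi> (\<tau> - t))"
  using lborel_integrable_real_affine[OF assms, of "-1" t]
    lborel_integrable_real_affine[OF assms, of 1 "- t"] by auto

lemma abs_integral_reflect_translate:
  fixes \<Phi> :: "real \<Rightarrow> real"
  shows "(LINT \<tau>|lborel. \<bar>\<Phi> (t - \<tau>)\<bar>) = (LINT \<tau>|lborel. \<bar>\<Phi> \<tau>\<bar>)"
  using lborel_integral_real_affine[of "-1" "\<lambda>x. \<bar>\<Phi> x\<bar>" t] by simp

lemma integrable_mult_bounded:
  fixes \<Phi> v :: "'a \<Rightarrow> real"
  assumes "integrable M \<Phi>" and [measurable]: "v \<in> borel_measurable M"
    and "\<And>x. \<bar>v x\<bar> \<le> B"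
  shows "integrable M (\<lambda>x. \<Phi> x * v x)"
proof (rule Bochner_Integration.integrable_bound)
  show "integrable M (\<lambda>x. B * \<Phi> x)" using assms(1) by simp
  show "(\<lambda>x. \<Phi> x * v x) \<in> borel_measurable M" using assms(1) by measurable
  show "AE x in M. norm (\<Phi> x * v x) \<le> norm (B * \<Phi> x)"
  proof (rule AE_I2)
    fix x
    have "\<bar>v x\<bar> * \<bar>\<Phi> x\<bar> \<le> \<bar>B\<bar> * \<bar>\<Phi> x\<bar>"
      by (rule mult_right_mono) (use assms(3)[of x] in auto)
    then show "norm (\<Phi> x * v x) \<le> norm (B * \<Phi> x)"
      by (simp add: abs_mult mult.commute)
  qed
qed

text \<open>The easy case of Young's inequality, an integrable kernel against a bounded function.
  The bound is uniform in \<open>t\<close>, and this is what supplies the dominating functions for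
  Fubini below.\<close>

lemma convolution_bound:
  fixes \<Phi> v :: "real \<Rightarrow> real"
  assumes \<Phi>: "integrable lborel \<Phi>" and v: "v \<in> borel_measurable borel" "\<And>x. \<bar>v x\<bar> \<le> B"
  shows "(LINT \<tau>|lborel. \<bar>\<Phi> (t - \<tau>) * v \<tau>\<bar>) \<le> B * (LINT x|lborel. \<bar>\<Phi> x\<bar>)"
proof -
  have "(LINT \<tau>|lborel. \<bar>\<Phi> (t - \<tau>) * v \<tau>\<bar>) \<le> (LINT \<tau>|lborel. B * \<bar>\<Phi> (t - \<tau>)\<bar>)"
  proof (rule integral_mono)
    show "integrable lborel (\<lambda>\<tau>. \<bar>\<Phi> (t - \<tau>) * v \<tau>\<bar>)"
      using integrable_mult_bounded[OF integrable_reflect_translate(1)[OF \<Phi>], of v B t] v by simp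
    show "integrable lborel (\<lambda>\<tau>. B * \<bar>\<Phi> (t - \<tau>)\<bar>)"
      using integrable_reflect_translate(1)[OF \<Phi>] by simp
    show "\<bar>\<Phi> (t - \<tau>) * v \<tau>\<bar> \<le> B * \<bar>\<Phi> (t - \<tau>)\<bar>" for \<tau>
      using mult_right_mono[OF v(2)[of \<tau>], of "\<bar>\<Phi> (t - \<tau>)\<bar>"] by (simp add: abs_mult mult.commute)
  qed
  then show ?thesis by (simp add: abs_integral_reflect_translate)
qed

text \<open>Both sides are iterated integrals of
  \<open>u t * \<Phi> (t - \<tau>) * v \<tau>\<close>, in opposite orders. Absolute integrability on
  the product holds because, by \<open>convolution_bound\<close>, integrating the modulus over
  \<open>\<tau>\<close> leaves at most a constant times \<open>\<bar>u t\<bar>\<close>.\<close>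

lemma convolution_adjoint:
  fixes \<Phi> u v :: "real \<Rightarrow> real"
  assumes \<Phi>: "integrable lborel \<Phi>" and u: "integrable lborel u"
    and v: "v \<in> borel_measurable borel" "\<And>x. \<bar>v x\<bar> \<le> B"
  shows "(LINT t|lborel. u t * (LINT \<tau>|lborel. \<Phi> (t - \<tau>) * v \<tau>)) =
    (LINT t|lborel. v t * (LINT \<tau>|lborel. \<Phi> (\<tau> - t) * u \<tau>))"
proof -
  have [measurable]: "\<Phi> \<in> borel_measurable borel" "u \<in> borel_measurable borel"
      "v \<in> borel_measurable borel"
    using \<Phi> u v by auto
  have int: "integrable (lborel \<Otimes>\<^sub>M lborel) (\<lambda>(t, \<tau>). u t * (\<Phi> (t - \<tau>) * v \<tau>))"
  proof (rule lborel_pair.Fubini_integrable)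
    show "(\<lambda>(t, \<tau>). u t * (\<Phi> (t - \<tau>) * v \<tau>)) \<in> borel_measurable (lborel \<Otimes>\<^sub>M lborel)"
      by measurable
    show "AE t in lborel. integrable lborel (\<lambda>\<tau>. case (t, \<tau>) of (t, \<tau>) \<Rightarrow> u t * (\<Phi> (t - \<tau>) * v \<tau>))"
      using integrable_mult_bounded[OF integrable_reflect_translate(1)[OF \<Phi>], of v B] v by simp
    show "integrable lborel (\<lambda>t. LINT \<tau>|lborel. norm (case (t, \<tau>) of (t, \<tau>) \<Rightarrow> u t * (\<Phi> (t - \<tau>) * v \<tau>)))"
    proof (rule Bochner_Integration.integrable_bound)
      show "integrable lborel (\<lambda>t. \<bar>u t\<bar> * (B * (LINT x|lborel. \<bar>\<Phi> x\<bar>)))" using u by simp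
      show "AE t in lborel. norm (LINT \<tau>|lborel. norm (case (t, \<tau>) of (t, \<tau>) \<Rightarrow> u t * (\<Phi> (t - \<tau>) * v \<tau>)))
          \<le> norm (\<bar>u t\<bar> * (B * (LINT x|lborel. \<bar>\<Phi> x\<bar>)))"
      proof (rule AE_I2)
        fix t
        have "(LINT \<tau>|lborel. \<bar>u t * (\<Phi> (t - \<tau>) * v \<tau>)\<bar>) = \<bar>u t\<bar> * (LINT \<tau>|lborel. \<bar>\<Phi> (t - \<tau>) * v \<tau>\<bar>)"
          by (simp add: abs_mult[of "u t"])
        also have "\<dots> \<le> \<bar>u t\<bar> * (B * (LINT x|lborel. \<bar>\<Phi> x\<bar>))"
          by (intro mult_left_mono convolution_bound \<Phi> v) auto
        finally show "norm (LINT \<tau>|lborel. norm (case (t, \<tau>) of (t, \<tau>) \<Rightarrow> u t * (\<Phi> (t - \<tau>) * v \<tau>)))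
            \<le> norm (\<bar>u t\<bar> * (B * (LINT x|lborel. \<bar>\<Phi> x\<bar>)))"
          by (simp add: abs_of_nonneg[OF Bochner_Integration.integral_nonneg])
      qed
    qed measurable
  qed
  have "(LINT t|lborel. u t * (LINT \<tau>|lborel. \<Phi> (t - \<tau>) * v \<tau>)) =
      (LINT t|lborel. LINT \<tau>|lborel. u t * (\<Phi> (t - \<tau>) * v \<tau>))"
    by simp
  also have "\<dots> = (LINT \<tau>|lborel. LINT t|lborel. u t * (\<Phi> (t - \<tau>) * v \<tau>))"
    using lborel_pair.Fubini_integral[OF int] by simp
  also have "\<dots> = (LINT \<tau>|lborel. LINT t|lborel. v \<tau> * (\<Phi> (t - \<tau>) * u t))"
    by (simp add: ac_simps)
  \<comment> \<open>For an exceptional \<open>\<tau>\<close> the function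
    \<open>\<Phi> (t - \<tau>) * u t\<close> of \<open>t\<close> may fail to be integrable. The
    factor \<open>v \<tau>\<close> still leaves the integral, since both sides are then 0 by the
    default value of the integral.\<close>
  finally show ?thesis by simp
qed

section \<open>Convolution in the first variable on the plane\<close>

text \<open>By \<open>convolution_bound\<close> the inner integral is a bounded function of
  \<open>(s, t)\<close>, so the product is dominated by a multiple of \<open>g\<close>.\<close>

lemma integrable_partial_convolution:
  fixes \<Phi> :: "real \<Rightarrow> real" and g h :: "real \<times> real \<Rightarrow> real"
  assumes \<Phi>: "integrable lborel \<Phi>" and g: "integrable lborel g"
    and h: "h \<in> borel_measurable borel" "\<And>x. \<bar>h x\<bar> \<le> B"
  shows "integrable lborel (\<lambda>(s, t). g (s, t) * (LINT \<tau>|lborel. \<Phi> (s - \<tau>) * h (\<tau>, t)))"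
proof -
  have [measurable]: "\<Phi> \<in> borel_measurable borel" "h \<in> borel_measurable (borel \<Otimes>\<^sub>M borel)"
    using \<Phi> h by (auto simp: borel_prod)
  have "integrable lborel (\<lambda>z. g z * (LINT \<tau>|lborel. \<Phi> (fst z - \<tau>) * h (\<tau>, snd z)))"
  proof (rule integrable_mult_bounded[OF g])
    have "(\<lambda>z. LINT \<tau>|lborel. \<Phi> (fst z - \<tau>) * h (\<tau>, snd z)) \<in> borel_measurable (borel \<Otimes>\<^sub>M borel)"
      by measurable
    then show "(\<lambda>z. LINT \<tau>|lborel. \<Phi> (fst z - \<tau>) * h (\<tau>, snd z)) \<in> borel_measurable lborel"
      by (simp add: borel_prod)
    show "\<bar>LINT \<tau>|lborel. \<Phi> (fst z - \<tau>) * h (\<tau>, snd z)\<bar> \<le> B * (LINT x|lborel. \<bar>\<Phi> x\<bar>)" for z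
      by (rule order_trans[OF integral_abs_bound convolution_bound[OF \<Phi>]]) (auto intro: h)
  qed
  then show ?thesis by (simp add: case_prod_beta')
qed

text \<open>Freeze \<open>t\<close>, apply \<open>convolution_adjoint\<close> in the first variable,
  and integrate over \<open>t\<close>. Each function occurs once as the integrable outer factor and
  once as the bounded inner one, hence the symmetric hypotheses on \<open>g\<close> and
  \<open>h\<close>.\<close>

lemma partial_convolution_adjoint:
  fixes \<Phi> :: "real \<Rightarrow> real" and g h :: "real \<times> real \<Rightarrow> real"
  assumes \<Phi>: "integrable lborel \<Phi>"
    and g: "integrable lborel g" "\<And>x. \<bar>g x\<bar> \<le> B" and h: "integrable lborel h" "\<And>x. \<bar>h x\<bar> \<le> C"
  shows "(LINT (s, t)|lborel. g (s, t) * (LINT \<tau>|lborel. \<Phi> (s - \<tau>) * h (\<tau>, t))) =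
    (LINT (s, t)|lborel. h (s, t) * (LINT \<tau>|lborel. \<Phi> (\<tau> - s) * g (\<tau>, t)))"
proof -
  have [measurable]: "\<Phi> \<in> borel_measurable borel" "g \<in> borel_measurable (borel \<Otimes>\<^sub>M borel)"
      "h \<in> borel_measurable (borel \<Otimes>\<^sub>M borel)"
    using \<Phi> g h by (auto simp: borel_prod)
  have [measurable]: "h \<in> borel_measurable borel" "g \<in> borel_measurable borel"
    using g h by auto
  \<comment> \<open>The right-hand side is a convolution with the reflected kernel, so the same
    integrability lemma covers it.\<close>
  have \<Phi>': "integrable lborel (\<lambda>x. \<Phi> (- x))"
    using integrable_reflect_translate(1)[OF \<Phi>, of 0] by simp
  have 1: "integrable (lborel \<Otimes>\<^sub>M lborel) (\<lambda>(s, t). g (s, t) * (LINT \<tau>|lborel. \<Phi> (s - \<tau>) * h (\<tau>, t)))"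
    unfolding lborel_prod by (intro integrable_partial_convolution \<Phi> g) (auto intro: h)
  have 2: "integrable (lborel \<Otimes>\<^sub>M lborel) (\<lambda>(s, t). h (s, t) * (LINT \<tau>|lborel. \<Phi> (\<tau> - s) * g (\<tau>, t)))"
    unfolding lborel_prod
    using integrable_partial_convolution[OF \<Phi>' h(1), of g B] g(2) by simp
  \<comment> \<open>Integrability of \<open>g\<close> on the plane yields integrable sections only
    for almost every \<open>t\<close>, so the slices are compared almost everywhere.\<close>
  have ae: "AE t in lborel. integrable lborel (\<lambda>s. g (s, t))"
    using lborel_pair.AE_integrable_snd[of "\<lambda>s t. g (s, t)"] g(1) by (simp add: lborel_prod)
  have "(LINT t|lborel. LINT s|lborel. g (s, t) * (LINT \<tau>|lborel. \<Phi> (s - \<tau>) * h (\<tau>, t))) =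
      (LINT t|lborel. LINT s|lborel. h (s, t) * (LINT \<tau>|lborel. \<Phi> (\<tau> - s) * g (\<tau>, t)))"
  proof (rule integral_cong_AE)
    show "AE t in lborel. (LINT s|lborel. g (s, t) * (LINT \<tau>|lborel. \<Phi> (s - \<tau>) * h (\<tau>, t))) =
        (LINT s|lborel. h (s, t) * (LINT \<tau>|lborel. \<Phi> (\<tau> - s) * g (\<tau>, t)))"
      using ae by eventually_elim (rule convolution_adjoint[OF \<Phi>], auto intro: h)
  qed measurable
  then show ?thesis
    using lborel_pair.integral_snd[OF 1] lborel_pair.integral_snd[OF 2] by (simp add: lborel_prod)
qed

section \<open>From the given Lebesgue integrals to Borel integrals\<close>

text \<open>The limits of integration are encoded in supports. In the left integral,
  \<open>\<kappa> (t - \<tau>)\<close> vanishes for \<open>\<tau> > t\<close> and \<open>u\<close>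
  vanishes for \<open>\<tau> < a\<close>; for \<open>\<tau>\<close> between \<open>a\<close> and
  \<open>t\<close> the argument \<open>t - \<tau>\<close> lies in \<open>[0, b - a]\<close>, where
  \<open>k\<close> and \<open>\<kappa>\<close> agree almost everywhere. The right integral is the
  mirror image.\<close>

lemma partial_operator_eq_convolution:
  fixes k \<kappa> h :: "real \<Rightarrow> real"
  assumes \<kappa>: "integrable lborel \<kappa>" "AE x in lborel. x \<in> {0..b - a} \<longrightarrow> k x = \<kappa> x"
      "\<And>x. x \<notin> {0..b - a} \<Longrightarrow> \<kappa> x = 0"
    and u: "u \<in> borel_measurable borel" "\<And>x. \<bar>u x\<bar> \<le> B"
      "\<And>x. x \<in> {a..b} \<Longrightarrow> u x = h x" "\<And>x. x \<notin> {a..b} \<Longrightarrow> u x = 0"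
    and t: "t \<in> {a..b}"
  shows "p * (LINT \<tau>:{a..t}|lebesgue. k (t - \<tau>) * h \<tau>) +
      q * (LINT \<tau>:{t..b}|lebesgue. k (\<tau> - t) * h \<tau>) =
    (LINT \<tau>|lborel. (p * \<kappa> (t - \<tau>) + q * \<kappa> (- (t - \<tau>))) * u \<tau>)"
proof -
  have [measurable]: "\<kappa> \<in> borel_measurable borel" "u \<in> borel_measurable borel"
    using \<kappa> u by auto
  have i1: "integrable lborel (\<lambda>\<tau>. \<kappa> (t - \<tau>) * u \<tau>)"
    using integrable_mult_bounded[OF integrable_reflect_translate(1)[OF \<kappa>(1)], of u B] u by simp
  have i2: "integrable lborel (\<lambda>\<tau>. \<kappa> (\<tau> - t) * u \<tau>)"
    using integrable_mult_bounded[OF integrable_reflect_translate(2)[OF \<kappa>(1)], of u B] u by simp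
  have ae1: "AE \<tau> in lborel. t - \<tau> \<in> {0..b - a} \<longrightarrow> k (t - \<tau>) = \<kappa> (t - \<tau>)"
    using AE_lborel_real_affine[OF \<kappa>(2), of "-1" t] by simp
  have ae2: "AE \<tau> in lborel. \<tau> - t \<in> {0..b - a} \<longrightarrow> k (\<tau> - t) = \<kappa> (\<tau> - t)"
    using AE_lborel_real_affine[OF \<kappa>(2), of 1 "- t"] by simp
  have "(LINT \<tau>:{a..t}|lebesgue. k (t - \<tau>) * h \<tau>) = (LINT \<tau>|lborel. \<kappa> (t - \<tau>) * u \<tau>)"
    unfolding set_lebesgue_integral_def
  proof (rule integral_lebesgue_cong_AE)
    show "AE \<tau> in lborel. indicator {a..t} \<tau> *\<^sub>R (k (t - \<tau>) * h \<tau>) = \<kappa> (t - \<tau>) * u \<tau>"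
      using ae1
    proof eventually_elim
      case (elim \<tau>)
      then show ?case
        using t u(3,4)[of \<tau>] \<kappa>(3)[of "t - \<tau>"] by (cases "\<tau> \<in> {a..t}"; cases "\<tau> \<in> {a..b}") auto
    qed
  qed measurable
  moreover have "(LINT \<tau>:{t..b}|lebesgue. k (\<tau> - t) * h \<tau>) = (LINT \<tau>|lborel. \<kappa> (\<tau> - t) * u \<tau>)"
    unfolding set_lebesgue_integral_def
  proof (rule integral_lebesgue_cong_AE)
    show "AE \<tau> in lborel. indicator {t..b} \<tau> *\<^sub>R (k (\<tau> - t) * h \<tau>) = \<kappa> (\<tau> - t) * u \<tau>"
      using ae2
    proof eventually_elim
      case (elim \<tau>)
      then show ?case
        using t u(3,4)[of \<tau>] \<kappa>(3)[of "\<tau> - t"] by (cases "\<tau> \<in> {t..b}"; cases "\<tau> \<in> {a..b}") auto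
    qed
  qed measurable
  ultimately show ?thesis
    using i1 i2 by (simp add: distrib_right mult.assoc)
qed

text \<open>\<open>G\<close> carries no measurability assumption: it is compared only on the
  rectangle with the Borel function \<open>F\<close>, whose vanishing outside absorbs both
  indicators. Fubini is then applied to \<open>F\<close> alone.\<close>

lemma lebesgue_integral_rectangle:
  fixes F G :: "real \<times> real \<Rightarrow> real"
  assumes F: "integrable lborel F"
    and eq: "\<And>s t. s \<in> {a..b} \<Longrightarrow> t \<in> {c..d} \<Longrightarrow> G (s, t) = F (s, t)"
    and zero: "\<And>z. z \<notin> {a..b} \<times> {c..d} \<Longrightarrow> F z = 0"
  shows "(LINT s:{a..b}|lebesgue. LINT t:{c..d}|lebesgue. G (s, t)) = integral\<^sup>L lborel F"
proof -
  have [measurable]: "F \<in> borel_measurable (borel \<Otimes>\<^sub>M borel)"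
    using F by (auto simp: borel_prod)
  have inner: "indicator {a..b} s *\<^sub>R (LINT t:{c..d}|lebesgue. G (s, t)) = (LINT t|lborel. F (s, t))" for s
  proof (cases "s \<in> {a..b}")
    case True
    have "(LINT t:{c..d}|lebesgue. G (s, t)) = (LINT t|lborel. F (s, t))"
      unfolding set_lebesgue_integral_def
      by (rule integral_lebesgue_cong_AE) (use True eq zero in \<open>auto simp: indicator_def\<close>)
    then show ?thesis using True by simp
  next
    case False
    then have "F (s, t) = 0" for t using zero[of "(s, t)"] by auto
    then show ?thesis using False by simp
  qed
  have "(LINT s:{a..b}|lebesgue. LINT t:{c..d}|lebesgue. G (s, t)) = (LINT s|lborel. LINT t|lborel. F (s, t))"
    unfolding set_lebesgue_integral_def[of _ "{a..b}"] inner
    by (rule integral_lebesgue_cong_AE) auto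
  also have "\<dots> = integral\<^sup>L lborel F"
    using lborel_pair.integral_fst[of "\<lambda>s t. F (s, t)"] F by (simp add: lborel_prod)
  finally show ?thesis .
qed

text \<open>The extension by zero may jump at the boundary, but compactness of the rectangle still
  gives it a bound and an integral over the plane.\<close>

lemma bounded_integrable_extension:
  fixes f :: "real \<times> real \<Rightarrow> real"
  assumes "continuous_on ({a..b} \<times> {c..d}) f"
  obtains F B where "integrable lborel F" "\<And>z. \<bar>F z\<bar> \<le> B"
    "\<And>z. z \<in> {a..b} \<times> {c..d} \<Longrightarrow> F z = f z" "\<And>z. z \<notin> {a..b} \<times> {c..d} \<Longrightarrow> F z = 0"
proof -
  have cpt: "compact ({a..b} \<times> {c..d})" by (intro compact_Times compact_Icc)
  then obtain B where "B > 0" and B: "\<And>z. z \<in> {a..b} \<times> {c..d} \<Longrightarrow> \<bar>f z\<bar> \<le> B"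
    using compact_imp_bounded[OF compact_continuous_image[OF assms]] by (force simp: bounded_pos)
  show ?thesis
    using that[of "\<lambda>z. indicator ({a..b} \<times> {c..d}) z *\<^sub>R f z" B]
      borel_integrable_compact[OF cpt assms] B \<open>B > 0\<close>
    by (auto simp: indicator_def)
qed

section \<open>Combining the operators in the two variables\<close>

theorem theorem3p1:
  fixes \<alpha> a1 b1 a2 b2 p1 q1 p2 q2 :: real
    and k :: "real \<Rightarrow> real \<Rightarrow> real"
    and P1 P2 :: param_set
    and f g \<eta>1 \<eta>2 :: "real \<times> real \<Rightarrow> real"
  assumes "0 < \<alpha>" and "\<alpha> < 1"
    and "a1 < b1" and "a2 < b2"
    and "P1 = Param a1 b1 p1 q1" and "P2 = Param a2 b2 p2 q2"
    and "set_integrable lebesgue {0..b1 - a1} (k \<alpha>)"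
    and "set_integrable lebesgue {0..b2 - a2} (k \<alpha>)"
    and "continuous_on ({a1..b1} \<times> {a2..b2}) f"
    and "continuous_on ({a1..b1} \<times> {a2..b2}) g"
    and "continuous_on ({a1..b1} \<times> {a2..b2}) \<eta>1"
    and "continuous_on ({a1..b1} \<times> {a2..b2}) \<eta>2"
  shows
    "(LINT t1:{a1..b1}|lebesgue. LINT t2:{a2..b2}|lebesgue.
        g (t1, t2) * K1 k P1 \<alpha> \<eta>1 (t1, t2) + f (t1, t2) * K2 k P2 \<alpha> \<eta>2 (t1, t2)) =
     (LINT t1:{a1..b1}|lebesgue. LINT t2:{a2..b2}|lebesgue.
        \<eta>1 (t1, t2) * K1 k (dual P1) \<alpha> g (t1, t2) + \<eta>2 (t1, t2) * K2 k (dual P2) \<alpha> f (t1, t2))"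
proof -
  define S where "S = {a1..b1} \<times> {a2..b2}"
  \<comment> \<open>Two representatives of the same \<open>k \<alpha>\<close> are chosen because the
    sides may differ in length, and each has to vanish outside its own interval
    \<open>[0, b1 - a1]\<close> or \<open>[0, b2 - a2]\<close>.\<close>
  obtain \<kappa>1 where \<kappa>1: "integrable lborel \<kappa>1" "AE x in lborel. x \<in> {0..b1 - a1} \<longrightarrow> k \<alpha> x = \<kappa>1 x"
      "\<And>x. x \<notin> {0..b1 - a1} \<Longrightarrow> \<kappa>1 x = 0"
    using borel_representative[OF assms(7)] by blast
  obtain \<kappa>2 where \<kappa>2: "integrable lborel \<kappa>2" "AE x in lborel. x \<in> {0..b2 - a2} \<longrightarrow> k \<alpha> x = \<kappa>2 x"
      "\<And>x. x \<notin> {0..b2 - a2} \<Longrightarrow> \<kappa>2 x = 0"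
    using borel_representative[OF assms(8)] by blast
  obtain F Bf where F: "integrable lborel F" "\<And>z. \<bar>F z\<bar> \<le> Bf"
      "\<And>z. z \<in> S \<Longrightarrow> F z = f z" "\<And>z. z \<notin> S \<Longrightarrow> F z = 0"
    by (rule bounded_integrable_extension[OF assms(9), folded S_def], rule that, assumption) auto
  obtain G Bg where G: "integrable lborel G" "\<And>z. \<bar>G z\<bar> \<le> Bg"
      "\<And>z. z \<in> S \<Longrightarrow> G z = g z" "\<And>z. z \<notin> S \<Longrightarrow> G z = 0"
    by (rule bounded_integrable_extension[OF assms(10), folded S_def], rule that, assumption) auto
  obtain H1 B1 where H1: "integrable lborel H1" "\<And>z. \<bar>H1 z\<bar> \<le> B1"
      "\<And>z. z \<in> S \<Longrightarrow> H1 z = \<eta>1 z" "\<And>z. z \<notin> S \<Longrightarrow> H1 z = 0"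
    by (rule bounded_integrable_extension[OF assms(11), folded S_def], rule that, assumption) auto
  obtain H2 B2 where H2: "integrable lborel H2" "\<And>z. \<bar>H2 z\<bar> \<le> B2"
      "\<And>z. z \<in> S \<Longrightarrow> H2 z = \<eta>2 z" "\<And>z. z \<notin> S \<Longrightarrow> H2 z = 0"
    by (rule bounded_integrable_extension[OF assms(12), folded S_def], rule that, assumption) auto
  \<comment> \<open>The coefficients remain arguments so that one definition serves an operator and
    its dual: \<open>\<Phi> q p x = \<Phi> p q (- x)\<close>, and likewise for
    \<open>\<Psi>\<close>.\<close>
  define \<Phi> where "\<Phi> p q x = p * \<kappa>1 x + q * \<kappa>1 (- x)" for p q x
  define \<Psi> where "\<Psi> p q x = p * \<kappa>2 x + q * \<kappa>2 (- x)" for p q x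
  have \<Phi>: "integrable lborel (\<Phi> p q)" and \<Psi>: "integrable lborel (\<Psi> p q)" for p q
    using integrable_reflect_translate(1)[OF \<kappa>1(1), of 0] integrable_reflect_translate(1)[OF \<kappa>2(1), of 0]
      \<kappa>1(1) \<kappa>2(1) by (simp_all add: \<Phi>_def[abs_def] \<Psi>_def[abs_def])
  have K1: "K1 k (Param a1 b1 p q) \<alpha> h (s, t) = (LINT \<tau>|lborel. \<Phi> p q (s - \<tau>) * H (\<tau>, t))"
    if H: "integrable lborel H" "\<And>z. \<bar>H z\<bar> \<le> B"
        "\<And>z. z \<in> S \<Longrightarrow> H z = h z" "\<And>z. z \<notin> S \<Longrightarrow> H z = 0"
      and st: "s \<in> {a1..b1}" "t \<in> {a2..b2}" for h H B p q s t
  proof -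
    have [measurable]: "H \<in> borel_measurable (borel \<Otimes>\<^sub>M borel)" using H by (auto simp: borel_prod)
    show ?thesis
      unfolding K1_def \<Phi>_def
      by (simp only: prod.case param_set.sel,
          rule partial_operator_eq_convolution[OF \<kappa>1, where B = B and u = "\<lambda>\<tau>. H (\<tau>, t)"])
        (use st H(2-4) in \<open>auto simp: S_def\<close>)
  qed
  have K2: "K2 k (Param a2 b2 p q) \<alpha> h (s, t) = (LINT \<tau>|lborel. \<Psi> p q (t - \<tau>) * H (s, \<tau>))"
    if H: "integrable lborel H" "\<And>z. \<bar>H z\<bar> \<le> B"
        "\<And>z. z \<in> S \<Longrightarrow> H z = h z" "\<And>z. z \<notin> S \<Longrightarrow> H z = 0"
      and st: "s \<in> {a1..b1}" "t \<in> {a2..b2}" for h H B p q s t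
  proof -
    have [measurable]: "H \<in> borel_measurable (borel \<Otimes>\<^sub>M borel)" using H by (auto simp: borel_prod)
    show ?thesis
      unfolding K2_def \<Psi>_def
      by (simp only: prod.case param_set.sel,
          rule partial_operator_eq_convolution[OF \<kappa>2, where B = B and u = "\<lambda>\<tau>. H (s, \<tau>)"])
        (use st H(2-4) in \<open>auto simp: S_def\<close>)
  qed
  define I where "I p q U V = (\<lambda>(s, t). U (s, t) * (LINT \<tau>|lborel. \<Phi> p q (s - \<tau>) * V (\<tau>, t)))"
    for p q and U V :: "real \<times> real \<Rightarrow> real"
  define J where "J p q U V = (\<lambda>(s, t). U (s, t) * (LINT \<tau>|lborel. \<Psi> p q (t - \<tau>) * V (s, \<tau>)))"
    for p q and U V :: "real \<times> real \<Rightarrow> real"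
  \<comment> \<open>Lebesgue measure on the plane is invariant under exchanging the coordinates.
    This reduces convolution in the second variable to the lemmas on the first.\<close>
  have swap: "integrable lborel (\<lambda>(s, t). U (t, s)) \<longleftrightarrow> integrable lborel U"
      "(LINT (s, t)|lborel. U (t, s)) = integral\<^sup>L lborel U"
    if "U \<in> borel_measurable borel" for U :: "real \<times> real \<Rightarrow> real"
    using lborel_pair.integrable_product_swap_iff[of U] lborel_pair.integral_product_swap[of U] that
    by (simp_all add: lborel_prod)
  have intI: "integrable lborel (I p q U V)"
    if "integrable lborel U" "integrable lborel V" "\<And>z. \<bar>V z\<bar> \<le> B" for p q U V B
    unfolding I_def by (rule integrable_partial_convolution[OF \<Phi> that(1) _ that(3)]) (use that in auto)
  \<comment> \<open>The exchanged \<open>U\<close> and \<open>V\<close> are kept as unreduced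
    abstractions, so that the right-hand side matches the integrand of
    \<open>integrable_partial_convolution\<close>.\<close>
  have Jswap: "J p q U V \<in> borel_measurable borel"
      "(\<lambda>(s, t). J p q U V (t, s)) = (\<lambda>(s, t). (\<lambda>(s, t). U (t, s)) (s, t) *
        (LINT \<tau>|lborel. \<Psi> p q (s - \<tau>) * (\<lambda>(s, t). V (t, s)) (\<tau>, t)))"
    if "integrable lborel U" "integrable lborel V" for p q U V
  proof -
    have [measurable]: "\<Psi> p q \<in> borel_measurable borel" "U \<in> borel_measurable (borel \<Otimes>\<^sub>M borel)"
        "V \<in> borel_measurable (borel \<Otimes>\<^sub>M borel)"
      using \<Psi> that by (auto simp: borel_prod)
    have "J p q U V \<in> borel_measurable (borel \<Otimes>\<^sub>M borel)"
      unfolding J_def by measurable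
    then show "J p q U V \<in> borel_measurable borel" by (simp add: borel_prod)
  qed (auto simp: J_def)
  have intJ: "integrable lborel (J p q U V)"
    if "integrable lborel U" "integrable lborel V" "\<And>z. \<bar>V z\<bar> \<le> B" for p q U V B
    unfolding swap(1)[OF Jswap(1)[OF that(1,2)], symmetric] Jswap(2)[OF that(1,2)]
    by (rule integrable_partial_convolution[OF \<Psi>, where B = B])
      (use that swap(1)[of U] swap(1)[of V] in auto)
  have adjI: "integral\<^sup>L lborel (I p q U V) = integral\<^sup>L lborel (I q p V U)"
    if "integrable lborel U" "\<And>z. \<bar>U z\<bar> \<le> A" "integrable lborel V" "\<And>z. \<bar>V z\<bar> \<le> B" for p q U V A B
    \<comment> \<open>The adjoint kernel \<open>\<Phi> p q (\<tau> - s)\<close> is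
      \<open>\<Phi> q p (s - \<tau>)\<close>: here the coefficients change places.\<close>
    using partial_convolution_adjoint[OF \<Phi>[of p q] that]
    by (simp add: I_def \<Phi>_def add.commute)
  have adjJ: "integral\<^sup>L lborel (J p q U V) = integral\<^sup>L lborel (J q p V U)"
    if UV: "integrable lborel U" "\<And>z. \<bar>U z\<bar> \<le> A" "integrable lborel V" "\<And>z. \<bar>V z\<bar> \<le> B" for p q U V A B
  proof -
    have "integrable lborel (\<lambda>(s, t). U (t, s))" "integrable lborel (\<lambda>(s, t). V (t, s))"
      using UV swap(1)[of U] swap(1)[of V] by auto
    from partial_convolution_adjoint[OF \<Psi>[of p q] this(1) _ this(2), of A B]
    show ?thesis
      unfolding swap(2)[OF Jswap(1)[OF UV(1,3)], symmetric] swap(2)[OF Jswap(1)[OF UV(3,1)], symmetric]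
      using UV by (simp add: J_def \<Psi>_def add.commute case_prod_beta')
  qed
  have "(LINT t1:{a1..b1}|lebesgue. LINT t2:{a2..b2}|lebesgue.
        g (t1, t2) * K1 k P1 \<alpha> \<eta>1 (t1, t2) + f (t1, t2) * K2 k P2 \<alpha> \<eta>2 (t1, t2)) =
      (LINT z|lborel. I p1 q1 G H1 z + J p2 q2 F H2 z)"
  proof (rule lebesgue_integral_rectangle[where G = "\<lambda>z. g z * K1 k P1 \<alpha> \<eta>1 z + f z * K2 k P2 \<alpha> \<eta>2 z"])
    show "integrable lborel (\<lambda>z. I p1 q1 G H1 z + J p2 q2 F H2 z)"
      by (intro Bochner_Integration.integrable_add intI[OF G(1) H1(1,2)] intJ[OF F(1) H2(1,2)])
    show "g (s, t) * K1 k P1 \<alpha> \<eta>1 (s, t) + f (s, t) * K2 k P2 \<alpha> \<eta>2 (s, t) = I p1 q1 G H1 (s, t) + J p2 q2 F H2 (s, t)"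
      if "s \<in> {a1..b1}" "t \<in> {a2..b2}" for s t
    proof -
      have "(s, t) \<in> S" using that by (simp add: S_def)
      then show ?thesis
        by (simp add: assms(5,6) K1[OF H1 that] K2[OF H2 that] G(3) F(3) I_def J_def)
    qed
    show "I p1 q1 G H1 z + J p2 q2 F H2 z = 0" if "z \<notin> {a1..b1} \<times> {a2..b2}" for z
      using G(4)[of z] F(4)[of z] that by (simp add: I_def J_def S_def case_prod_beta')
  qed
  \<comment> \<open>On the plane both integrands are integrable, so the sum splits and each operator
    is transposed separately.\<close>
  also have "\<dots> = integral\<^sup>L lborel (I p1 q1 G H1) + integral\<^sup>L lborel (J p2 q2 F H2)"
    by (intro Bochner_Integration.integral_add intI[OF G(1) H1(1,2)] intJ[OF F(1) H2(1,2)])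
  also have "\<dots> = integral\<^sup>L lborel (I q1 p1 H1 G) + integral\<^sup>L lborel (J q2 p2 H2 F)"
    by (simp add: adjI[OF G(1,2) H1(1,2)] adjJ[OF F(1,2) H2(1,2)])
  also have "\<dots> = (LINT z|lborel. I q1 p1 H1 G z + J q2 p2 H2 F z)"
    by (intro Bochner_Integration.integral_add[symmetric] intI[OF H1(1) G(1,2)] intJ[OF H2(1) F(1,2)])
  also have "\<dots> = (LINT t1:{a1..b1}|lebesgue. LINT t2:{a2..b2}|lebesgue.
        \<eta>1 (t1, t2) * K1 k (dual P1) \<alpha> g (t1, t2) + \<eta>2 (t1, t2) * K2 k (dual P2) \<alpha> f (t1, t2))"
  proof (rule lebesgue_integral_rectangle[symmetric, where G =
        "\<lambda>z. \<eta>1 z * K1 k (dual P1) \<alpha> g z + \<eta>2 z * K2 k (dual P2) \<alpha> f z"])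
    show "integrable lborel (\<lambda>z. I q1 p1 H1 G z + J q2 p2 H2 F z)"
      by (intro Bochner_Integration.integrable_add intI[OF H1(1) G(1,2)] intJ[OF H2(1) F(1,2)])
    show "\<eta>1 (s, t) * K1 k (dual P1) \<alpha> g (s, t) + \<eta>2 (s, t) * K2 k (dual P2) \<alpha> f (s, t) = I q1 p1 H1 G (s, t) + J q2 p2 H2 F (s, t)"
      if "s \<in> {a1..b1}" "t \<in> {a2..b2}" for s t
    proof -
      have "(s, t) \<in> S" using that by (simp add: S_def)
      then show ?thesis
        by (simp add: assms(5,6) dual_def K1[OF G that] K2[OF F that] H1(3) H2(3) I_def J_def)
    qed
    show "I q1 p1 H1 G z + J q2 p2 H2 F z = 0" if "z \<notin> {a1..b1} \<times> {a2..b2}" for z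
      using H1(4)[of z] H2(4)[of z] that by (simp add: I_def J_def S_def case_prod_beta')
  qed
  finally show ?thesis .
qed

end
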